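(* Let $r\ge 1$, $0<c<1$, and let $\beta_1,\ldots,\beta_r>0$ satisfy $\beta_i-\beta_j\notin\mathbb{Z}$ whenever $i\neq j$. Let $M^{(2)}_{\vec n}$, $\vec n=(n_1,\ldots,n_r)\in\mathbb{N}^r$, be the multiple Meixner polynomials of the second kind with parameters $\beta_1,\ldots,\beta_r$ and $c$. Then for every $\vec n\in\mathbb{N}^r$ and every $k\in\{1,\ldots,r\}$, $$xM^{(2)}_{\vec n}(x)=M^{(2)}_{\vec n+\vec e_k}(x)+\left(\frac{c}{1-c}(n_k+\beta_k)+\frac{|\vec n|}{1-c}\right)M^{(2)}_{\vec n}(x)+\sum_{j=1}^r\frac{c\,n_j(n_j+\beta_j-1)}{(1-c)^2}\left(\prod_{\substack{1\le i\le r\\ i\neq j}}\frac{n_j+\beta_j-\beta_i}{n_j+\beta_j-n_i-\beta_i}\right)M^{(2)}_{\vec n-\vec e_j}(x).$$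
   Context: $\mathbb{N}=\{0,1,2,\ldots\}$. For $\vec n=(n_1,\ldots,n_r)\in\mathbb{N}^r$, $|\vec n|=n_1+\cdots+n_r$; $\vec e_k=(0,\ldots,0,1,0,\ldots,0)$ is the $k$th unit vector in $\mathbb{N}^r$. The Pochhammer symbol is $(a)_0=1$, $(a)_k=a(a+1)\cdots(a+k-1)$. The multiple Meixner polynomial of the second kind $M^{(2)}_{\vec n}$ (with parameters $\beta_1,\ldots,\beta_r>0$, $\beta_i-\beta_j\notin\mathbb{Z}$ for $i\ne j$, and $0<c<1$) is the unique monic polynomial of degree $|\vec n|$ in one variable satisfying $$\sum_{k=0}^\infty M^{(2)}_{\vec n}(k)\,k^\ell\,\frac{(\beta_j)_k c^k}{k!}=0,\qquad \ell=0,1,\ldots,n_j-1,\quad j=1,\ldots,r.$$ Terms in the last sum with $n_j=0$ are understood to be $0$. *)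

theory Defs
  imports "HOL-Analysis.Analysis" "HOL-Computational_Algebra.Polynomial"
begin

definition multi_size :: "nat ^ 'r \<Rightarrow> nat" where
  "multi_size n = (\<Sum>i\<in>UNIV. n $ i)"

definition is_multiple_meixner2 ::
    "real ^ 'r \<Rightarrow> real \<Rightarrow> nat ^ 'r \<Rightarrow> real poly \<Rightarrow> bool" where
  "is_multiple_meixner2 \<beta> c n P \<longleftrightarrow>
     lead_coeff P = 1 \<and> degree P = multi_size n \<and>
     (\<forall>j. \<forall>l < n $ j.
        (\<lambda>k. poly P (real k) * real k ^ l * (pochhammer (\<beta> $ j) k * c ^ k / fact k)) sums 0)"

definition multiple_meixner2 ::
    "real ^ 'r \<Rightarrow> real \<Rightarrow> nat ^ 'r \<Rightarrow> real poly" where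
  "multiple_meixner2 \<beta> c n = (THE P. is_multiple_meixner2 \<beta> c n P)"

end

theory Submission
  imports Defs
begin

text \<open>
  Summing a polynomial \<open>P\<close> against the weight \<open>(s)\<^sub>k c\<^sup>k / k!\<close> gives \<open>(1 - c)\<close> to the power \<open>-s\<close>
  times a polynomial \<open>F\<close> in \<open>s\<close>, and \<open>P \<mapsto> F\<close> is a degree-preserving linear bijection which turns
  multiplication by \<open>x\<close> into \<open>F(s) \<mapsto> s (F(s + 1) / (1 - c) - F(s))\<close>. Orthogonality of \<open>P\<close> to the
  powers below \<open>n\<^sub>j\<close> for the weight with parameter \<open>\<beta>\<^sub>j\<close> means that \<open>F\<close> vanishes at \<open>\<beta>\<^sub>j + l\<close> for
  \<open>l < n\<^sub>j\<close>. Hence the multiple Meixner polynomial corresponds, up to a power of \<open>c / (1 - c)\<close>, to the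
  product of all \<open>s - \<beta>\<^sub>j - l\<close>. After cancelling common factors, the recurrence becomes a
  partial fraction identity with the nodes \<open>\<beta>\<^sub>j + n\<^sub>j - 1\<close>, \<open>n\<^sub>j > 0\<close>.
\<close>

section \<open>The series transform and multiplication by \<open>x\<close>\<close>

definition meixner_shift :: "real \<Rightarrow> real poly \<Rightarrow> real poly" where
  "meixner_shift c F = [:0, 1:] * (smult (1 / (1 - c)) (F \<circ>\<^sub>p [:1, 1:]) - F)"

text \<open>A relation rather than a function, so that linearity follows directly from limits of
  series, before existence and uniqueness of \<open>F\<close> are known. The range
  \<open>s > 0\<close> contains every \<beta>-parameter, is closed under \<open>s + 1\<close>, and
  is infinite, hence determines the polynomial \<open>F\<close>.\<close>

definition meixner_transform :: "real \<Rightarrow> real poly \<Rightarrow> real poly \<Rightarrow> bool" where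
  "meixner_transform c P F \<longleftrightarrow>
     (\<forall>s>0. (\<lambda>k. poly P (real k) * (pochhammer s k * c ^ k / fact k))
              sums ((1 - c) powr (- s) * poly F s))"

definition node_poly :: "real ^ 'r \<Rightarrow> nat ^ 'r \<Rightarrow> real poly" where
  "node_poly \<beta> n = (\<Prod>j\<in>UNIV. \<Prod>l<n $ j. [:- (\<beta> $ j + real l), 1:])"

lemma poly_meixner_shift:
  "poly (meixner_shift c F) s = s * (poly F (s + 1) / (1 - c) - poly F s)"
  by (simp add: meixner_shift_def poly_pcompose algebra_simps)

text \<open>This is the binomial series of \<open>(1 - c) powr (- s)\<close>: the sign in
  \<open>(- s) gchoose k\<close> cancels against that of \<open>(- c) ^ k\<close>.\<close>

lemma pochhammer_series:
  fixes s c :: real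
  assumes "\<bar>c\<bar> < 1"
  shows "(\<lambda>k. pochhammer s k * c ^ k / fact k) sums ((1 - c) powr (- s))"
proof -
  have "(\<lambda>k. ((- s) gchoose k) * (- c) ^ k) sums (1 + (- c)) powr (- s)"
    using assms by (intro gen_binomial_real) auto
  moreover have "((- s) gchoose k) * (- c) ^ k = pochhammer s k * c ^ k / fact k" for k
    by (simp add: gbinomial_pochhammer flip: power_mult_distrib)
  ultimately show ?thesis by simp
qed

lemma meixner_transform_const:
  assumes "0 < c" "c < 1"
  shows "meixner_transform c [:a:] [:a:]"
  unfolding meixner_transform_def
  using sums_mult[OF pochhammer_series[of c], where c = a] assms by (simp add: mult.commute)

lemma meixner_transform_add:
  assumes "meixner_transform c P F" "meixner_transform c Q G"
  shows "meixner_transform c (P + Q) (F + G)"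
  unfolding meixner_transform_def
proof (intro allI impI)
  fix s :: real assume "s > 0"
  with assms show "(\<lambda>k. poly (P + Q) (real k) * (pochhammer s k * c ^ k / fact k))
      sums ((1 - c) powr (- s) * poly (F + G) s)"
    unfolding meixner_transform_def poly_add distrib_left distrib_right
    by (intro sums_add) auto
qed

lemma meixner_transform_smult:
  assumes "meixner_transform c P F"
  shows "meixner_transform c (smult a P) (smult a F)"
  unfolding meixner_transform_def
proof (intro allI impI)
  fix s :: real assume "s > 0"
  with assms have "(\<lambda>k. poly P (real k) * (pochhammer s k * c ^ k / fact k))
      sums ((1 - c) powr (- s) * poly F s)"
    unfolding meixner_transform_def by auto
  from sums_mult[OF this, of a]
  show "(\<lambda>k. poly (smult a P) (real k) * (pochhammer s k * c ^ k / fact k))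
      sums ((1 - c) powr (- s) * poly (smult a F) s)"
    by (simp add: mult_ac)
qed

lemma meixner_transform_diff:
  assumes "meixner_transform c P F" "meixner_transform c Q G"
  shows "meixner_transform c (P - Q) (F - G)"
  using meixner_transform_add[OF assms(1) meixner_transform_smult[OF assms(2), of "-1"]]
  by simp

lemma meixner_transform_0: "meixner_transform c 0 0"
  by (simp add: meixner_transform_def)

lemma meixner_transform_sum:
  assumes "\<And>i. i \<in> A \<Longrightarrow> meixner_transform c (P i) (F i)"
  shows "meixner_transform c (\<Sum>i\<in>A. P i) (\<Sum>i\<in>A. F i)"
  using assms
  by (induction A rule: infinite_finite_induct)
     (auto intro: meixner_transform_add meixner_transform_0)

text \<open>From \<open>s * pochhammer (s + 1) k = (s + k) * pochhammer s k\<close>, the weight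
  times \<open>k\<close> is \<open>s\<close> times the difference of the weights with parameters
  \<open>s + 1\<close> and \<open>s\<close>. The prefactor \<open>(1 - c) powr (- (s + 1))\<close>
  of the first accounts for the division by \<open>1 - c\<close> in
  \<open>meixner_shift\<close>.\<close>

lemma meixner_transform_times_x:
  assumes "c < 1" "meixner_transform c P F"
  shows "meixner_transform c ([:0, 1:] * P) (meixner_shift c F)"
  unfolding meixner_transform_def
proof (intro allI impI)
  fix s :: real assume "s > 0"
  have shift: "s * pochhammer (s + 1) k = (s + real k) * pochhammer s k" for k
    by (metis pochhammer_rec pochhammer_rec')
  have sums: "(\<lambda>k. poly P (real k) * (pochhammer u k * c ^ k / fact k))
      sums ((1 - c) powr (- u) * poly F u)" if "u > 0" for u
    using assms(2) that unfolding meixner_transform_def by blast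
  have "(\<lambda>k. s * (poly P (real k) * (pochhammer (s + 1) k * c ^ k / fact k))
           - s * (poly P (real k) * (pochhammer s k * c ^ k / fact k)))
      sums (s * ((1 - c) powr (- (s + 1)) * poly F (s + 1)) - s * ((1 - c) powr (- s) * poly F s))"
    using \<open>s > 0\<close> by (intro sums_diff sums_mult sums) auto
  moreover have "s * (poly P (real k) * (pochhammer (s + 1) k * c ^ k / fact k))
           - s * (poly P (real k) * (pochhammer s k * c ^ k / fact k))
         = poly ([:0, 1:] * P) (real k) * (pochhammer s k * c ^ k / fact k)" for k
  proof -
    have "s * (poly P (real k) * (pochhammer (s + 1) k * c ^ k / fact k))
           - s * (poly P (real k) * (pochhammer s k * c ^ k / fact k))
       = (s * pochhammer (s + 1) k - s * pochhammer s k) * (poly P (real k) * (c ^ k / fact k))"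
      by (simp add: algebra_simps)
    also have "\<dots> = real k * pochhammer s k * (poly P (real k) * (c ^ k / fact k))"
      unfolding shift by (simp add: algebra_simps)
    finally show ?thesis by (simp add: algebra_simps)
  qed
  moreover have "(1 - c) powr (- (s + 1)) = (1 - c) powr (- s) / (1 - c)"
    using \<open>c < 1\<close> by (simp add: powr_diff)
  ultimately show "(\<lambda>k. poly ([:0, 1:] * P) (real k) * (pochhammer s k * c ^ k / fact k))
      sums ((1 - c) powr (- s) * poly (meixner_shift c F) s)"
    by (simp add: poly_meixner_shift algebra_simps)
qed

lemma meixner_transform_unique:
  assumes "c < 1" "meixner_transform c P F" "meixner_transform c P G"
  shows "F = G"
proof (rule ccontr)
  assume "F \<noteq> G"
  have "poly F s = poly G s" if "s > 0" for s
    using that assms sums_unique2 unfolding meixner_transform_def by fastforce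
  then have "{0<..} \<subseteq> {s. poly (F - G) s = 0}" by auto
  moreover have "finite {s. poly (F - G) s = 0}"
    using \<open>F \<noteq> G\<close> by (intro poly_roots_finite) auto
  ultimately show False
    using infinite_Ioi[of "0::real"] finite_subset by blast
qed

section \<open>Degrees, leading coefficients and bijectivity of the transform\<close>

text \<open>Translating the argument keeps the leading coefficient, so the new one is multiplied by
  \<open>1 / (1 - c) - 1 = c / (1 - c)\<close>. Giving a degree bound and a coefficient instead of
  the exact degree covers \<open>F = 0\<close> as well.\<close>

lemma coeff_meixner_shift:
  assumes "c < 1"
  shows "degree (meixner_shift c F) \<le> Suc (degree F)"
    and "coeff (meixner_shift c F) (Suc (degree F)) = c / (1 - c) * lead_coeff F"
proof -
  have "lead_coeff (F \<circ>\<^sub>p [:1, 1:]) = lead_coeff F"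
    by (subst lead_coeff_comp) auto
  then have *: "coeff (F \<circ>\<^sub>p [:1, 1:]) (degree F) = lead_coeff F"
    by (simp add: degree_pcompose)
  have "degree (smult (1 / (1 - c)) (F \<circ>\<^sub>p [:1, 1:]) - F) \<le> degree F"
    by (intro degree_diff_le) (simp_all add: degree_pcompose)
  then show "degree (meixner_shift c F) \<le> Suc (degree F)"
    by (simp add: meixner_shift_def degree_pCons_le le_trans)
  show "coeff (meixner_shift c F) (Suc (degree F)) = c / (1 - c) * lead_coeff F"
    using assms by (simp add: meixner_shift_def * field_simps)
qed

text \<open>Induction along Horner's scheme: \<open>pCons a P\<close> is \<open>a + x P\<close>, and
  each multiplication by \<open>x\<close> raises the degree by one and contributes one factor
  \<open>c / (1 - c)\<close>, which is nonzero.\<close>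

lemma meixner_transform_exists:
  assumes "0 < c" "c < 1"
  shows "\<exists>F. meixner_transform c P F \<and> degree F = degree P \<and>
             lead_coeff F = (c / (1 - c)) ^ degree P * lead_coeff P"
proof (induction P)
  case 0
  then show ?case by (auto intro: exI[of _ 0] meixner_transform_0)
next
  case (pCons a P)
  then obtain F where F: "meixner_transform c P F" "degree F = degree P"
    "lead_coeff F = (c / (1 - c)) ^ degree P * lead_coeff P" by blast
  show ?case
  proof (cases "P = 0")
    case True
    then show ?thesis using meixner_transform_const[OF assms, of a]
      by (intro exI[of _ "[:a:]"]) auto
  next
    case False
    let ?F = "[:a:] + meixner_shift c F"
    have c: "coeff ?F (Suc (degree P)) = (c / (1 - c)) ^ Suc (degree P) * lead_coeff P"
      using coeff_meixner_shift(2)[OF assms(2), of F] F(2,3) by (simp add: mult_ac)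
    have "degree ?F \<le> Suc (degree P)"
      using coeff_meixner_shift(1)[OF assms(2), of F] F(2) by (intro degree_add_le) auto
    moreover have "coeff ?F (Suc (degree P)) \<noteq> 0"
      unfolding c using False assms by simp
    ultimately have d: "degree ?F = Suc (degree P)"
      by (simp add: le_antisym le_degree)
    have "meixner_transform c ([:a:] + [:0, 1:] * P) ?F"
      using assms F(1) by (intro meixner_transform_add meixner_transform_const meixner_transform_times_x)
    then show ?thesis using False d c by (intro exI[of _ ?F]) auto
  qed
qed

lemma meixner_transform_lead_coeff:
  assumes "0 < c" "c < 1" "meixner_transform c P F"
  shows "degree F = degree P" and "lead_coeff F = (c / (1 - c)) ^ degree P * lead_coeff P"
  using meixner_transform_exists[OF assms(1,2), of P] meixner_transform_unique[OF assms(2,3)]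
  by auto

text \<open>\<open>P - Q\<close> has transform 0, and leading coefficients are only scaled by a
  nonzero factor, so that of \<open>P - Q\<close> is 0.\<close>

lemma meixner_transform_inj:
  assumes "0 < c" "c < 1" "meixner_transform c P F" "meixner_transform c Q F"
  shows "P = Q"
proof -
  have "lead_coeff (P - Q) = 0"
    using meixner_transform_lead_coeff(2)[OF assms(1,2) meixner_transform_diff[OF assms(3,4)]] assms
    by auto
  then have "P - Q = 0" by (simp only: leading_coeff_0_iff)
  then show ?thesis by simp
qed

text \<open>The image \<open>G\<close> of the monomial of degree \<open>degree F\<close> has the
  same degree as \<open>F\<close>; subtracting the multiple of \<open>G\<close> that cancels the
  leading term of \<open>F\<close> lowers the degree.\<close>

lemma meixner_transform_surj:
  assumes "0 < c" "c < 1"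
  shows "\<exists>P. meixner_transform c P F"
proof (induction "degree F" arbitrary: F rule: less_induct)
  case less
  obtain G where G: "meixner_transform c (monom 1 (degree F)) G" "degree G = degree F"
    "lead_coeff G = (c / (1 - c)) ^ degree F"
    using meixner_transform_exists[OF assms, of "monom 1 (degree F)"] by (auto simp: degree_monom_eq)
  define a where "a = lead_coeff F / lead_coeff G"
  have "lead_coeff G \<noteq> 0" using G(3) assms by auto
  show ?case
  proof (cases "degree F = 0")
    case True
    then show ?thesis using meixner_transform_const[OF assms] by (metis degree_0_id)
  next
    case False
    have "degree (F - smult a G) \<le> degree F"
      using G(2) by (intro degree_diff_le) auto
    moreover have "coeff (F - smult a G) (degree F) = 0"
      using G(2) \<open>lead_coeff G \<noteq> 0\<close> by (simp add: a_def)
    ultimately have "degree (F - smult a G) < degree F"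
      using False by (metis coeff_0_degree_minus_1 diff_less eq_zero_or_degree_less le_less_trans
          degree_0 bot_nat_0.not_eq_extremum)
    from less[OF this] obtain P where "meixner_transform c P (F - smult a G)" by blast
    from meixner_transform_add[OF this meixner_transform_smult[OF G(1), of a]]
    show ?thesis by auto
  qed
qed

section \<open>Orthogonality as vanishing at nodes\<close>

text \<open>The induction peels off the innermost shift and applies the hypothesis to
  \<open>meixner_shift c F\<close>, whose zeros link the values of \<open>F\<close> at consecutive
  points.\<close>

lemma funpow_meixner_shift_zeros:
  assumes "c < 1" "s > 0"
  shows "(\<forall>l<m. poly ((meixner_shift c ^^ l) F) s = 0) \<longleftrightarrow> (\<forall>l<m. poly F (s + real l) = 0)"
proof (induction m arbitrary: F)
  case (Suc m)
  have "(\<forall>l<Suc m. poly ((meixner_shift c ^^ l) F) s = 0) \<longleftrightarrow>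
        poly F s = 0 \<and> (\<forall>l<m. poly ((meixner_shift c ^^ l) (meixner_shift c F)) s = 0)"
    by (simp add: All_less_Suc2 funpow_swap1)
  also have "\<dots> \<longleftrightarrow> poly F s = 0 \<and> (\<forall>l<m. poly (meixner_shift c F) (s + real l) = 0)"
    by (simp add: Suc.IH)
  also have "\<dots> \<longleftrightarrow> poly F s = 0 \<and> (\<forall>l<m. poly F (s + real l + 1) = (1 - c) * poly F (s + real l))"
  proof -
    \<comment> \<open>The factor \<open>s + real l\<close> in front of \<open>meixner_shift\<close>
      must be cancelled; this is where positivity of \<open>s\<close> enters.\<close>
    have "s + real l \<noteq> 0" for l using assms by (metis add_pos_nonneg less_irrefl of_nat_0_le_iff)
    then have "poly (meixner_shift c F) (s + real l) = 0
        \<longleftrightarrow> poly F (s + real l + 1) = (1 - c) * poly F (s + real l)" for l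
      using assms by (simp add: poly_meixner_shift divide_eq_eq mult.commute)
    then show ?thesis by simp
  qed
  also have "\<dots> \<longleftrightarrow> (\<forall>l<Suc m. poly F (s + real l) = 0)"
  proof
    assume *: "poly F s = 0 \<and> (\<forall>l<m. poly F (s + real l + 1) = (1 - c) * poly F (s + real l))"
    \<comment> \<open>The zero at \<open>s\<close> propagates upwards, since each value is
      \<open>1 - c\<close> times the previous one.\<close>
    have "l < Suc m \<Longrightarrow> poly F (s + real l) = 0" for l
      by (induction l) (use * in \<open>auto simp: add_ac\<close>)
    then show "\<forall>l<Suc m. poly F (s + real l) = 0" by blast
  next
    assume *: "\<forall>l<Suc m. poly F (s + real l) = 0"
    have "poly F s = 0" using *[rule_format, of 0] by simp
    moreover have "poly F (s + real l + 1) = 0" if "l < m" for l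
      using *[rule_format, of "Suc l"] that by (simp add: add_ac)
    ultimately show "poly F s = 0 \<and> (\<forall>l<m. poly F (s + real l + 1) = (1 - c) * poly F (s + real l))"
      using * by simp
  qed
  finally show ?case .
qed simp

text \<open>The factor \<open>real k ^ l\<close> in a moment becomes \<open>l\<close> applications
  of \<open>meixner_shift\<close>, and the prefactor \<open>(1 - c) powr (- s)\<close> never
  vanishes.\<close>

lemma orthogonality_iff_zeros:
  assumes "0 < c" "c < 1" "s > 0" "meixner_transform c P F"
  shows "(\<forall>l<m. (\<lambda>k. poly P (real k) * real k ^ l * (pochhammer s k * c ^ k / fact k)) sums 0)
         \<longleftrightarrow> (\<forall>l<m. poly F (s + real l) = 0)"
proof -
  have tr: "meixner_transform c ([:0, 1:] ^ l * P) ((meixner_shift c ^^ l) F)" for l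
  proof (induction l)
    case (Suc l)
    from meixner_transform_times_x[OF assms(2) this] show ?case by (simp add: mult_ac)
  qed (use assms in simp)
  have S: "(\<lambda>k. poly P (real k) * real k ^ l * (pochhammer s k * c ^ k / fact k))
          sums ((1 - c) powr (- s) * poly ((meixner_shift c ^^ l) F) s)" for l
  proof -
    have "poly ([:0, 1:] ^ l * P) (real k) = poly P (real k) * real k ^ l" for k
      by (simp add: poly_power mult.commute)
    moreover have "(\<lambda>k. poly ([:0, 1:] ^ l * P) (real k) * (pochhammer s k * c ^ k / fact k))
        sums ((1 - c) powr (- s) * poly ((meixner_shift c ^^ l) F) s)"
      using tr[of l] assms(3) unfolding meixner_transform_def by blast
    ultimately show ?thesis by (simp only:)
  qed
  have "(\<lambda>k. poly P (real k) * real k ^ l * (pochhammer s k * c ^ k / fact k)) sums 0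
      \<longleftrightarrow> poly ((meixner_shift c ^^ l) F) s = 0" for l
  proof
    assume "(\<lambda>k. poly P (real k) * real k ^ l * (pochhammer s k * c ^ k / fact k)) sums 0"
    from sums_unique2[OF S this] show "poly ((meixner_shift c ^^ l) F) s = 0"
      using assms(2) by simp
  next
    assume "poly ((meixner_shift c ^^ l) F) s = 0"
    with S[of l] show "(\<lambda>k. poly P (real k) * real k ^ l * (pochhammer s k * c ^ k / fact k)) sums 0"
      by (simp only: mult_zero_right)
  qed
  then show ?thesis
    using funpow_meixner_shift_zeros[OF assms(2,3), of m F] by (simp only:)
qed

lemma degree_node_poly: "degree (node_poly \<beta> n) = multi_size n"
  and monic_node_poly: "lead_coeff (node_poly \<beta> n) = 1"
proof -
  show "lead_coeff (node_poly \<beta> n) = 1"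
    by (simp add: node_poly_def lead_coeff_prod)
  show "degree (node_poly \<beta> n) = multi_size n"
    by (simp add: node_poly_def degree_prod_eq_sum_degree multi_size_def)
qed

lemma poly_node_poly:
  "poly (node_poly \<beta> n) s = (\<Prod>j\<in>UNIV. \<Prod>l<n $ j. s - (\<beta> $ j + real l))"
  by (simp add: node_poly_def poly_prod algebra_simps)

lemma poly_node_poly_eq_0:
  assumes "l < n $ j"
  shows "poly (node_poly \<beta> n) (\<beta> $ j + real l) = 0"
  unfolding poly_node_poly using assms
  by (intro prod_zero bexI[of _ j]) (auto intro!: bexI[of _ l])

text \<open>The nodes are pairwise distinct, because a coincidence between two indices would make a
  difference of parameters an integer. So there are \<open>multi_size n\<close> of them, and a
  polynomial of that degree vanishing at all of them is fixed by its leading coefficient.\<close>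

lemma zeros_iff_node_poly:
  fixes \<beta> :: "real ^ 'r" and n :: "nat ^ 'r"
  assumes "\<And>i j. i \<noteq> j \<Longrightarrow> \<beta> $ i - \<beta> $ j \<notin> \<int>" and "degree F = multi_size n"
  shows "(\<forall>j. \<forall>l<n $ j. poly F (\<beta> $ j + real l) = 0) \<longleftrightarrow>
         F = smult (lead_coeff F) (node_poly \<beta> n)"
proof
  assume F: "\<forall>j. \<forall>l<n $ j. poly F (\<beta> $ j + real l) = 0"
  let ?g = "\<lambda>(j, l). \<beta> $ j + real l"
  let ?A = "SIGMA j:UNIV. {..<n $ j}"
  have inj: "inj_on ?g ?A"
  proof (rule inj_onI, clarify)
    fix i j l m assume eq: "\<beta> $ i + real l = \<beta> $ j + real m"
    then have "\<beta> $ i - \<beta> $ j = of_int (int m - int l)" by simp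
    then have "i = j" using assms(1) Ints_of_int by metis
    with eq show "i = j \<and> l = m" by simp
  qed
  show "F = smult (lead_coeff F) (node_poly \<beta> n)"
  proof (rule poly_eqI_degree_lead_coeff[where A = "?g ` ?A" and n = "multi_size n"])
    show "coeff F (multi_size n) = coeff (smult (lead_coeff F) (node_poly \<beta> n)) (multi_size n)"
      using assms(2) degree_node_poly[of \<beta> n] monic_node_poly[of \<beta> n] by simp
    show "multi_size n \<le> card (?g ` ?A)"
      by (simp add: card_image[OF inj] card_SigmaI multi_size_def)
    show "degree (smult (lead_coeff F) (node_poly \<beta> n)) \<le> multi_size n"
      using degree_smult_le[of "lead_coeff F" "node_poly \<beta> n"] degree_node_poly[of \<beta> n] by simp
  qed (use F assms(2) in \<open>auto simp: poly_node_poly_eq_0\<close>)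
next
  assume F: "F = smult (lead_coeff F) (node_poly \<beta> n)"
  show "\<forall>j. \<forall>l<n $ j. poly F (\<beta> $ j + real l) = 0"
    by (subst F) (auto simp: poly_node_poly_eq_0)
qed

lemma is_multiple_meixner2_iff:
  fixes \<beta> :: "real ^ 'r" and n :: "nat ^ 'r"
  assumes "0 < c" "c < 1" "\<And>i. \<beta> $ i > 0"
    and "\<And>i j. i \<noteq> j \<Longrightarrow> \<beta> $ i - \<beta> $ j \<notin> \<int>"
  shows "is_multiple_meixner2 \<beta> c n P \<longleftrightarrow>
         meixner_transform c P (smult ((c / (1 - c)) ^ multi_size n) (node_poly \<beta> n))"
proof -
  define t where "t = c / (1 - c)"
  have "t \<noteq> 0" using assms by (simp add: t_def)
  obtain F where F: "meixner_transform c P F" "degree F = degree P"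
      "lead_coeff F = t ^ degree P * lead_coeff P"
    using meixner_transform_exists[OF assms(1,2)] unfolding t_def by blast
  have "is_multiple_meixner2 \<beta> c n P \<longleftrightarrow>
      lead_coeff P = 1 \<and> degree P = multi_size n \<and> (\<forall>j. \<forall>l<n $ j. poly F (\<beta> $ j + real l) = 0)"
    unfolding is_multiple_meixner2_def
    using orthogonality_iff_zeros[OF assms(1,2,3) F(1)] by simp
  also have "\<dots> \<longleftrightarrow> lead_coeff P = 1 \<and> degree P = multi_size n \<and> 
      F = smult (t ^ multi_size n) (node_poly \<beta> n)"
    using zeros_iff_node_poly[OF assms(4), where F = F and n = n] F(2,3)
    by (metis mult.right_neutral)
  also have "\<dots> \<longleftrightarrow> F = smult (t ^ multi_size n) (node_poly \<beta> n)"
  proof -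
    \<comment> \<open>The normalisation of \<open>P\<close> can be read back from \<open>F\<close>:
      degrees agree, and the nonzero power of \<open>t\<close> cancels.\<close>
    have "lead_coeff P = 1 \<and> degree P = multi_size n" if "F = smult (t ^ multi_size n) (node_poly \<beta> n)"
    proof -
      have "degree F = multi_size n" "lead_coeff F = t ^ multi_size n"
        using that \<open>t \<noteq> 0\<close> degree_node_poly[of \<beta> n] monic_node_poly[of \<beta> n] by auto
      then show ?thesis using F(2,3) \<open>t \<noteq> 0\<close> by auto
    qed
    then show ?thesis by blast
  qed
  also have "\<dots> \<longleftrightarrow> meixner_transform c P (smult (t ^ multi_size n) (node_poly \<beta> n))"
    using F(1) meixner_transform_unique[OF assms(2)] by blast
  finally show ?thesis unfolding t_def .
qed

text \<open>Surjectivity and injectivity of the transform give exactly one polynomial with the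
  defining properties, so the definite description denotes it.\<close>

lemma meixner_transform_multiple_meixner2:
  fixes \<beta> :: "real ^ 'r" and n :: "nat ^ 'r"
  assumes "0 < c" "c < 1" "\<And>i. \<beta> $ i > 0"
    and "\<And>i j. i \<noteq> j \<Longrightarrow> \<beta> $ i - \<beta> $ j \<notin> \<int>"
  shows "meixner_transform c (multiple_meixner2 \<beta> c n)
           (smult ((c / (1 - c)) ^ multi_size n) (node_poly \<beta> n))"
proof -
  obtain P where P: "meixner_transform c P (smult ((c / (1 - c)) ^ multi_size n) (node_poly \<beta> n))"
    using meixner_transform_surj[OF assms(1,2)] by blast
  then have "multiple_meixner2 \<beta> c n = P"
    unfolding multiple_meixner2_def
    using meixner_transform_inj[OF assms(1,2)] is_multiple_meixner2_iff[OF assms]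
    by (intro the_equality) blast+
  with P show ?thesis by simp
qed

section \<open>A partial fraction identity\<close>

text \<open>Both products are monic of degree \<open>card J + 1\<close> with the same second
  coefficient, so their difference has degree below \<open>card J\<close>. Stating this
  coefficientwise also covers empty \<open>J\<close>, where the difference is 0.\<close>

lemma coeff_prod_shift_defect:
  fixes a \<gamma> :: "'i \<Rightarrow> 'a::comm_ring_1"
  assumes "finite J" "card J \<le> m"
  shows "coeff ([:0, 1:] * (\<Prod>j\<in>J. [:a j - \<gamma> j, 1:])
               - [:\<Sum>j\<in>J. a j, 1:] * (\<Prod>j\<in>J. [:- \<gamma> j, 1:])) m = 0"
  using assms
proof (induction J arbitrary: m rule: finite_induct)
  case empty
  then show ?case by simp
next
  case (insert j J)
  define p where "p = (\<Prod>j\<in>J. [:a j - \<gamma> j, 1:])"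
  define q where "q = (\<Prod>j\<in>J. [:- \<gamma> j, 1:])"
  define D where "D = [:0, 1:] * p - [:\<Sum>j\<in>J. a j, 1:] * q"
  obtain m' where m: "m = Suc m'" "card J \<le> m'"
    using insert by (cases m) auto
  have "degree q \<le> card J"
  proof -
    have "degree q \<le> (\<Sum>j\<in>J. degree [:- \<gamma> j, 1:])"
      unfolding q_def by (rule order_trans[OF degree_prod_sum_le]) (use insert in \<open>auto simp: o_def\<close>)
    also have "\<dots> \<le> (\<Sum>j\<in>J. 1)" by (intro sum_mono) auto
    finally show ?thesis by simp
  qed
  then have q0: "coeff q m = 0" using m by (intro coeff_eq_0) auto
  \<comment> \<open>A new index multiplies the old defect by a linear factor and adds a multiple of
    \<open>q\<close>. Coefficient \<open>m\<close> of the result involves only coefficients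
    \<open>m\<close> and \<open>m'\<close> of \<open>D\<close> and coefficient \<open>m\<close> of
    \<open>q\<close>, all zero.\<close>
  have "[:0, 1:] * (\<Prod>j\<in>insert j J. [:a j - \<gamma> j, 1:])
          - [:\<Sum>j\<in>insert j J. a j, 1:] * (\<Prod>j\<in>insert j J. [:- \<gamma> j, 1:])
        = [:a j - \<gamma> j, 1:] * D + smult (a j * ((\<Sum>j\<in>J. a j) + \<gamma> j)) q"
  proof -
    have ring: "X * ((A - B + X) * p) - (A + S + X) * ((- B + X) * q)
        = (A - B + X) * (X * p - (S + X) * q) + A * (S + B) * q" for X A B S :: "'a poly"
      by (simp add: algebra_simps)
    have lin: "[:u, 1:] = [:u:] + [:0, 1:]" for u :: 'a by simp
    have const: "[:u + v:] = [:u:] + [:v:]" "[:u - v:] = [:u:] - [:v:]" "[:- u:] = - [:u:]"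
      "smult (u * v) q = [:u:] * [:v:] * q" for u v :: 'a
      by (simp_all add: mult.commute)
    show ?thesis
      unfolding D_def prod.insert[OF insert(1,2)] sum.insert[OF insert(1,2)]
        p_def[symmetric] q_def[symmetric]
      unfolding lin[of "_ + _"] lin[of "_ - _"] lin[of "- _"] lin[of "sum _ _"] const ring ..
  qed
  moreover have "coeff D m' = 0" "coeff D m = 0"
    using insert.IH[of m'] insert.IH[of m] m by (simp_all add: D_def p_def q_def)
  ultimately show ?case
    using q0 m(1) by simp
qed

text \<open>Lagrange interpolation of the defect at the \<open>card J\<close> points
  \<open>\<gamma> j\<close>. With denominators in \<open>s\<close> cleared, the identity also holds
  at those points.\<close>

lemma prod_shift_partial_fractions:
  fixes a \<gamma> :: "'i \<Rightarrow> 'a::field"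
  assumes "finite J" "inj_on \<gamma> J"
  shows "s * (\<Prod>j\<in>J. s - \<gamma> j + a j) = (s + (\<Sum>j\<in>J. a j)) * (\<Prod>j\<in>J. s - \<gamma> j)
      + (\<Sum>j\<in>J. \<gamma> j * a j * (\<Prod>i\<in>J - {j}. (\<gamma> j - \<gamma> i + a i) / (\<gamma> j - \<gamma> i))
             * (\<Prod>i\<in>J - {j}. s - \<gamma> i))"
proof -
  define R where "R = (\<lambda>j. \<gamma> j * a j * (\<Prod>i\<in>J - {j}. (\<gamma> j - \<gamma> i + a i) / (\<gamma> j - \<gamma> i)))"
  define D where "D = [:0, 1:] * (\<Prod>j\<in>J. [:a j - \<gamma> j, 1:])
               - [:\<Sum>j\<in>J. a j, 1:] * (\<Prod>j\<in>J. [:- \<gamma> j, 1:])"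
  define E where "E = (\<Sum>j\<in>J. smult (R j) (\<Prod>i\<in>J - {j}. [:- \<gamma> i, 1:]))"
  have pD: "poly D s = s * (\<Prod>j\<in>J. s - \<gamma> j + a j) - (s + (\<Sum>j\<in>J. a j)) * (\<Prod>j\<in>J. s - \<gamma> j)" for s
    by (simp add: D_def poly_prod algebra_simps)
  have pE: "poly E s = (\<Sum>j\<in>J. R j * (\<Prod>i\<in>J - {j}. s - \<gamma> i))" for s
    by (simp add: E_def poly_prod poly_sum)
  have root: "poly D (\<gamma> j) = poly E (\<gamma> j)" if j: "j \<in> J" for j
  proof -
    have "(\<Prod>i\<in>J. \<gamma> j - \<gamma> i) = 0" using assms j by (intro prod_zero) auto
    then have "poly D (\<gamma> j) = \<gamma> j * (a j * (\<Prod>i\<in>J - {j}. \<gamma> j - \<gamma> i + a i))"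
      using assms j by (simp add: pD prod.remove[of J j])
    moreover have "poly E (\<gamma> j) = (\<Sum>i\<in>{j}. R i * (\<Prod>i'\<in>J - {i}. \<gamma> j - \<gamma> i'))"
      \<comment> \<open>All other summands of \<open>E\<close> contain the factor that vanishes at
        \<open>\<gamma> j\<close>.\<close>
      unfolding pE using assms j by (intro sum.mono_neutral_right) (auto intro!: prod_zero)
    moreover have "(\<Prod>i\<in>J - {j}. \<gamma> j - \<gamma> i) \<noteq> 0"
      using assms j by (auto simp: inj_on_def)
    ultimately show ?thesis by (simp add: R_def prod_dividef)
  qed
  have "D = E"
  proof (cases "J = {}")
    case True
    then show ?thesis by (simp add: D_def E_def)
  next
    case False
    then have pos: "card J > 0" using assms by (simp add: card_gt_0_iff)
    have "degree (\<Prod>i\<in>J - {j}. [:- \<gamma> i, 1:]) < card J" if "j \<in> J" for j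
      using that pos by (subst degree_prod_eq_sum_degree) (auto simp: card_Diff_singleton)
    then have "degree E < card J"
      unfolding E_def using pos
      by (intro degree_sum_less) (auto intro: le_less_trans[OF degree_smult_le])
    moreover have "degree D < card J"
      using pos coeff_prod_shift_defect[OF assms(1)] by (intro degree_lessI) (auto simp: D_def)
    ultimately show ?thesis
      using root by (intro poly_eqI_degree[where A = "\<gamma> ` J"]) (auto simp: card_image[OF assms(2)])
  qed
  then have "poly D s = poly E s" by simp
  then show ?thesis by (simp add: pD pE R_def algebra_simps)
qed

section \<open>The shift operator on node polynomials\<close>

lemma multi_size_add_axis: "multi_size (n + axis k 1) = Suc (multi_size n)"
  by (simp add: multi_size_def sum.distrib axis_def)

lemma multi_size_diff_axis:
  assumes "n $ j > 0"
  shows "multi_size n = Suc (multi_size (n - axis j 1))"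
proof -
  \<comment> \<open>Subtraction on naturals truncates; it is exact here because
    \<open>n $ j > 0\<close>.\<close>
  have "n - axis j 1 + axis j 1 = n"
    using assms by (auto simp: vec_eq_iff axis_def)
  then show ?thesis by (metis multi_size_add_axis)
qed

lemma poly_node_poly_add_axis:
  "poly (node_poly \<beta> (n + axis k 1)) s = (s - \<beta> $ k - real (n $ k)) * poly (node_poly \<beta> n) s"
proof -
  have "poly (node_poly \<beta> (n + axis k 1)) s =
      (\<Prod>j\<in>UNIV. (if j = k then s - \<beta> $ k - real (n $ k) else 1) * (\<Prod>l<n $ j. s - (\<beta> $ j + real l)))"
    unfolding poly_node_poly by (intro prod.cong) (auto simp: axis_def algebra_simps)
  then show ?thesis by (simp add: prod.distrib poly_node_poly)
qed

text \<open>\<open>G\<close> keeps all nodes except the top one, \<open>\<gamma> j\<close>, of each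
  nonempty string. Moving the argument to \<open>s + 1\<close> moves the nodes down by one, so the
  string of \<open>j\<close> then consists of the nodes in \<open>G\<close> and a new lowest one,
  \<open>\<beta> $ j - 1 = \<gamma> j - n $ j\<close>.\<close>

lemma node_poly_factorization:
  fixes \<beta> :: "real ^ 'r" and n :: "nat ^ 'r" and s :: real
  assumes \<gamma>: "\<And>j. \<gamma> j = \<beta> $ j + real (n $ j) - 1"
  defines "J \<equiv> {j. n $ j > 0}"
    and "G \<equiv> \<Prod>j\<in>UNIV. \<Prod>l<n $ j - 1. s - (\<beta> $ j + real l)"
  shows "poly (node_poly \<beta> n) s = (\<Prod>j\<in>J. s - \<gamma> j) * G"
    and "poly (node_poly \<beta> n) (s + 1) = (\<Prod>j\<in>J. s - \<gamma> j + real (n $ j)) * G"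
    and "j \<in> J \<Longrightarrow> poly (node_poly \<beta> (n - axis j 1)) s = (\<Prod>i\<in>J - {j}. s - \<gamma> i) * G"
proof -
  have combine: "(\<Prod>j\<in>K. f j) * G
      = (\<Prod>j\<in>UNIV. (if j \<in> K then f j else 1) * (\<Prod>l<n $ j - 1. s - (\<beta> $ j + real l)))"
    for K and f :: "'r \<Rightarrow> real"
    unfolding G_def prod.distrib by (simp add: prod.inter_restrict[of UNIV, symmetric])
  show "poly (node_poly \<beta> n) s = (\<Prod>j\<in>J. s - \<gamma> j) * G"
    unfolding poly_node_poly combine
  proof (intro prod.cong refl)
    fix j
    show "(\<Prod>l<n $ j. s - (\<beta> $ j + real l))
        = (if j \<in> J then s - \<gamma> j else 1) * (\<Prod>l<n $ j - 1. s - (\<beta> $ j + real l))"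
      by (cases "n $ j") (simp_all add: J_def \<gamma>)
  qed
  show "poly (node_poly \<beta> n) (s + 1) = (\<Prod>j\<in>J. s - \<gamma> j + real (n $ j)) * G"
    unfolding poly_node_poly combine
  proof (intro prod.cong refl)
    fix j
    show "(\<Prod>l<n $ j. s + 1 - (\<beta> $ j + real l))
        = (if j \<in> J then s - \<gamma> j + real (n $ j) else 1) * (\<Prod>l<n $ j - 1. s - (\<beta> $ j + real l))"
      \<comment> \<open>The product is split at \<open>l = 0\<close> here, not at its top
        index.\<close>
      by (cases "n $ j") (simp_all add: J_def \<gamma> prod.lessThan_Suc_shift algebra_simps del: prod.lessThan_Suc)
  qed
  show "poly (node_poly \<beta> (n - axis j 1)) s = (\<Prod>i\<in>J - {j}. s - \<gamma> i) * G" if "j \<in> J"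
    unfolding poly_node_poly combine
  proof (intro prod.cong refl)
    fix i
    show "(\<Prod>l<(n - axis j 1) $ i. s - (\<beta> $ i + real l))
        = (if i \<in> J - {j} then s - \<gamma> i else 1) * (\<Prod>l<n $ i - 1. s - (\<beta> $ i + real l))"
      by (cases "n $ i") (auto simp: J_def \<gamma> axis_def)
  qed
qed

lemma meixner_shift_node_poly:
  fixes \<beta> :: "real ^ 'r" and n :: "nat ^ 'r" and s c :: real
  assumes "c < 1" and nonint: "\<And>i j. i \<noteq> j \<Longrightarrow> \<beta> $ i - \<beta> $ j \<notin> \<int>"
  shows "poly (meixner_shift c (node_poly \<beta> n)) s
       = (c * s / (1 - c) + real (multi_size n) / (1 - c)) * poly (node_poly \<beta> n) s
       + (\<Sum>j | n $ j > 0. (real (n $ j) + \<beta> $ j - 1) * real (n $ j) / (1 - c)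
           * (\<Prod>i\<in>UNIV - {j}. (real (n $ j) + \<beta> $ j - \<beta> $ i)
                / (real (n $ j) + \<beta> $ j - real (n $ i) - \<beta> $ i))
           * poly (node_poly \<beta> (n - axis j 1)) s)"
proof -
  define J where "J = {j. n $ j > 0}"
  define \<gamma> where "\<gamma> = (\<lambda>j. \<beta> $ j + real (n $ j) - 1)"
  define G where "G = (\<Prod>j\<in>UNIV. \<Prod>l<n $ j - 1. s - (\<beta> $ j + real l))"
  define C where "C = (\<lambda>j. \<Prod>i\<in>UNIV - {j}. (real (n $ j) + \<beta> $ j - \<beta> $ i)
                / (real (n $ j) + \<beta> $ j - real (n $ i) - \<beta> $ i))"
  have "\<gamma> j = \<beta> $ j + real (n $ j) - 1" for j by (simp add: \<gamma>_def)
  note fact = node_poly_factorization[OF this, where s = s, folded J_def G_def]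
  have ne: "\<gamma> i \<noteq> \<gamma> j" if "i \<noteq> j" for i j
  proof
    assume "\<gamma> i = \<gamma> j"
    then have "\<beta> $ i - \<beta> $ j = of_int (int (n $ j) - int (n $ i))" by (simp add: \<gamma>_def)
    then show False using nonint[OF that] Ints_of_int by metis
  qed
  \<comment> \<open>An index with \<open>n $ i = 0\<close> contributes equal numerator and
    denominator, nonzero by \<open>ne\<close>, so the product may be restricted to
    \<open>J\<close>.\<close>
  have C: "C j = (\<Prod>i\<in>J - {j}. (\<gamma> j - \<gamma> i + real (n $ i)) / (\<gamma> j - \<gamma> i))" for j
    unfolding C_def
  proof (rule prod.mono_neutral_cong_right)
    show "\<forall>i\<in>UNIV - {j} - (J - {j}). (real (n $ j) + \<beta> $ j - \<beta> $ i)
                / (real (n $ j) + \<beta> $ j - real (n $ i) - \<beta> $ i) = 1"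
    proof
      fix i assume "i \<in> UNIV - {j} - (J - {j})"
      then show "(real (n $ j) + \<beta> $ j - \<beta> $ i)
                / (real (n $ j) + \<beta> $ j - real (n $ i) - \<beta> $ i) = 1"
        using ne[of i j] by (auto simp: J_def \<gamma>_def algebra_simps)
    qed
  qed (auto simp: \<gamma>_def algebra_simps)
  have size: "(\<Sum>j\<in>J. real (n $ j)) = real (multi_size n)"
    unfolding multi_size_def of_nat_sum
    by (intro sum.mono_neutral_left) (auto simp: J_def)
  have "s * poly (node_poly \<beta> n) (s + 1) = s * (\<Prod>j\<in>J. s - \<gamma> j + real (n $ j)) * G"
    by (simp add: fact)
  \<comment> \<open>The partial fraction identity with \<open>a j = n $ j\<close>, whose sum over
    \<open>J\<close> is \<open>multi_size n\<close>.\<close>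
  also have "\<dots> = ((s + real (multi_size n)) * (\<Prod>j\<in>J. s - \<gamma> j)
      + (\<Sum>j\<in>J. \<gamma> j * real (n $ j) * C j * (\<Prod>i\<in>J - {j}. s - \<gamma> i))) * G"
    unfolding C size[symmetric]
    using ne by (subst prod_shift_partial_fractions) (auto simp: inj_on_def)
  also have "\<dots> = (s + real (multi_size n)) * poly (node_poly \<beta> n) s
      + (\<Sum>j\<in>J. \<gamma> j * real (n $ j) * C j * poly (node_poly \<beta> (n - axis j 1)) s)"
    by (simp add: fact distrib_right sum_distrib_right mult.assoc del: One_nat_def)
  finally have "s * poly (node_poly \<beta> n) (s + 1) = \<dots>" .
  then have "poly (meixner_shift c (node_poly \<beta> n)) s
      = ((s + real (multi_size n)) * poly (node_poly \<beta> n) s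
      + (\<Sum>j\<in>J. \<gamma> j * real (n $ j) * C j * poly (node_poly \<beta> (n - axis j 1)) s)) / (1 - c)
      - s * poly (node_poly \<beta> n) s"
    by (simp add: poly_meixner_shift right_diff_distrib)
  also have "\<dots> = (c * s / (1 - c) + real (multi_size n) / (1 - c)) * poly (node_poly \<beta> n) s
      + (\<Sum>j\<in>J. \<gamma> j * real (n $ j) * C j * poly (node_poly \<beta> (n - axis j 1)) s) / (1 - c)"
  proof -
    have "((s + m) * N + R) / (1 - c) - s * N = (c * s / (1 - c) + m / (1 - c)) * N + R / (1 - c)"
      for m N R :: real
      using \<open>c < 1\<close> by (simp add: divide_simps) (simp add: algebra_simps)
    then show ?thesis .
  qed
  finally show ?thesis
    unfolding C_def J_def \<gamma>_def by (simp add: sum_divide_distrib add_ac)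
qed

section \<open>Transfer of the recurrence back through the transform\<close>

theorem theorem4:
  fixes \<beta> :: "real ^ 'r" and c :: real and n :: "nat ^ 'r" and k :: 'r and x :: real
  assumes "0 < c" and "c < 1"
    and "\<And>i. \<beta> $ i > 0"
    and "\<And>i j. i \<noteq> j \<Longrightarrow> \<beta> $ i - \<beta> $ j \<notin> \<int>"
  shows "x * poly (multiple_meixner2 \<beta> c n) x =
      poly (multiple_meixner2 \<beta> c (n + axis k 1)) x
    + (c / (1 - c) * (real (n $ k) + \<beta> $ k) + real (multi_size n) / (1 - c))
        * poly (multiple_meixner2 \<beta> c n) x
    + (\<Sum>j | n $ j > 0.
         c * real (n $ j) * (real (n $ j) + \<beta> $ j - 1) / (1 - c)\<^sup>2
         * (\<Prod>i\<in>UNIV - {j}. (real (n $ j) + \<beta> $ j - \<beta> $ i)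
              / (real (n $ j) + \<beta> $ j - real (n $ i) - \<beta> $ i))
         * poly (multiple_meixner2 \<beta> c (n - axis j 1)) x)"
proof -
  define t where "t = c / (1 - c)"
  define A where "A = t * (real (n $ k) + \<beta> $ k) + real (multi_size n) / (1 - c)"
  define C where "C = (\<lambda>j. \<Prod>i\<in>UNIV - {j}. (real (n $ j) + \<beta> $ j - \<beta> $ i)
              / (real (n $ j) + \<beta> $ j - real (n $ i) - \<beta> $ i))"
  define B where "B = (\<lambda>j. c * real (n $ j) * (real (n $ j) + \<beta> $ j - 1) / (1 - c)\<^sup>2 * C j)"
  define J where "J = {j. n $ j > 0}"
  define M where "M = multiple_meixner2 \<beta> c"
  define W where "W = (\<lambda>n. smult (t ^ multi_size n) (node_poly \<beta> n))"
  have M: "meixner_transform c (M n) (W n)" for n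
    unfolding M_def W_def t_def by (rule meixner_transform_multiple_meixner2[OF assms])
  have shift: "meixner_shift c (W n)
      = W (n + axis k 1) + smult A (W n) + (\<Sum>j\<in>J. smult (B j) (W (n - axis j 1)))"
  proof (rule poly_ext)
    fix s
    \<comment> \<open>\<open>W (n - axis j 1)\<close> carries one power of \<open>t\<close> less;
      the missing one is taken from \<open>c / (1 - c)\<^sup>2 = t / (1 - c)\<close>.\<close>
    have B: "poly (smult (B j) (W (n - axis j 1))) s
        = t ^ multi_size n * ((real (n $ j) + \<beta> $ j - 1) * real (n $ j) / (1 - c) * C j
            * poly (node_poly \<beta> (n - axis j 1)) s)" if "j \<in> J" for j
      using multi_size_diff_axis[of n j] that assms(1,2)
      by (simp add: W_def B_def t_def J_def power2_eq_square)
    have "poly (meixner_shift c (W n)) s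
        = t ^ multi_size n * poly (meixner_shift c (node_poly \<beta> n)) s"
      by (simp add: poly_meixner_shift W_def algebra_simps)
    also have "poly (meixner_shift c (node_poly \<beta> n)) s
        = (c * s / (1 - c) + real (multi_size n) / (1 - c)) * poly (node_poly \<beta> n) s
        + (\<Sum>j\<in>J. (real (n $ j) + \<beta> $ j - 1) * real (n $ j) / (1 - c) * C j
            * poly (node_poly \<beta> (n - axis j 1)) s)"
      unfolding C_def J_def by (rule meixner_shift_node_poly[OF assms(2,4)])
    also have "t ^ multi_size n * \<dots> = t ^ multi_size n
          * ((c * s / (1 - c) + real (multi_size n) / (1 - c)) * poly (node_poly \<beta> n) s)
        + (\<Sum>j\<in>J. poly (smult (B j) (W (n - axis j 1))) s)"
      unfolding distrib_left sum_distrib_left using B by (simp only: cong: sum.cong)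
    \<comment> \<open>The choice of \<open>k\<close> enters only here: \<open>t * s\<close> splits
      as \<open>t * (s - \<beta> $ k - n $ k)\<close>, which produces the extra node of
      \<open>n + axis k 1\<close>, plus \<open>t * (n $ k + \<beta> $ k)\<close>, which goes into
      \<open>A\<close>.\<close>
    also have "t ^ multi_size n
          * ((c * s / (1 - c) + real (multi_size n) / (1 - c)) * poly (node_poly \<beta> n) s)
        = poly (W (n + axis k 1) + smult A (W n)) s"
      by (simp add: W_def A_def t_def multi_size_add_axis poly_node_poly_add_axis algebra_simps
            del: One_nat_def)
    finally show "poly (meixner_shift c (W n)) s = poly (W (n + axis k 1) + smult A (W n)
        + (\<Sum>j\<in>J. smult (B j) (W (n - axis j 1)))) s"
      by (simp add: poly_sum)
  qed
  have "[:0, 1:] * M n = M (n + axis k 1) + smult A (M n) + (\<Sum>j\<in>J. smult (B j) (M (n - axis j 1)))"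
  proof (rule meixner_transform_inj[OF assms(1,2)])
    show "meixner_transform c ([:0, 1:] * M n) (meixner_shift c (W n))"
      using assms(2) M by (rule meixner_transform_times_x)
    show "meixner_transform c
        (M (n + axis k 1) + smult A (M n) + (\<Sum>j\<in>J. smult (B j) (M (n - axis j 1))))
        (meixner_shift c (W n))"
      unfolding shift
      by (intro meixner_transform_add meixner_transform_sum meixner_transform_smult M)
  qed
  then have "poly ([:0, 1:] * M n) x = poly (M (n + axis k 1) + smult A (M n) + (\<Sum>j\<in>J. smult (B j) (M (n - axis j 1)))) x"
    by simp
  then show ?thesis
    by (simp add: poly_sum A_def B_def C_def J_def M_def t_def)
qed

end
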